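(* Let $H$ be a real mixed Hodge structure. Then $\alpha(H)=0$ if and only if $H$ is $\mathbf R$-split.
   Context: A real mixed Hodge structure $H$ is a finite-dimensional real vector space $H_{\mathbf R}$ with an increasing exhaustive filtration $W_\bullet$ and a decreasing exhaustive filtration $F^\bullet$ on $H_{\mathbf C}=H_{\mathbf R}\otimes\mathbf C$, with conjugate $\overline F^\bullet$, such that $Gr_F^pGr_{\overline F}^qGr^W_nH_{\mathbf C}=0$ if $p+q\ne n$ ($W_\bullet$ also denotes the complexified filtration). The level of $\mathbf R$-splitting of $H$ is $\alpha(H)=\frac12\sum_{p,q}(p+q)^2(h_H^{p,q}-s_H^{p,q})$, where $h_H^{p,q}=\dim_{\mathbf C}Gr_{\overline F}^qGr_F^pGr^W_{p+q}H_{\mathbf C}$ and $s_H^{p,q}=\dim_{\mathbf C}Gr_F^pGr_{\overline F}^qH_{\mathbf C}$. (It equals $c_2$ of the Rees bundle on $\mathbf P^2$ associated with $H$.) Put $I^{p,q}=(F^p\cap W_{p+q})\cap\bigl(\overline F^q\cap W_{p+q}+\sum_{i\ge1}\overline F^{q-i}\cap W_{p+q-i-1}\bigr)$. $H$ is $\mathbf R$-split if $I^{p,q}=\overline{I^{q,p}}$ for all $p,q$. *)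

theory Defs
  imports "HOL-Analysis.Analysis"
begin

section \<open>Complexification of a real vector space\<close>

text \<open>The complexification of a real vector space is modelled on pairs, where \<open>(x, y)\<close>
  stands for \<open>x \<otimes> 1 + y \<otimes> \<i>\<close>.\<close>

definition cscale :: "complex \<Rightarrow> 'v \<times> 'v \<Rightarrow> 'v \<times> 'v::real_vector" where
  "cscale z v = (Re z *\<^sub>R fst v - Im z *\<^sub>R snd v, Re z *\<^sub>R snd v + Im z *\<^sub>R fst v)"

global_interpretation cplx: vector_space "cscale :: complex \<Rightarrow> 'v \<times> 'v \<Rightarrow> 'v \<times> 'v::real_vector"
  by standard (auto simp: cscale_def algebra_simps)

definition cconj :: "'v \<times> 'v \<Rightarrow> 'v \<times> 'v::real_vector" where
  "cconj v = (fst v, - snd v)"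

definition conj_filtration :: "(int \<Rightarrow> ('v \<times> 'v) set) \<Rightarrow> int \<Rightarrow> ('v \<times> 'v::real_vector) set" where
  "conj_filtration F p = cconj ` F p"

definition complexify_filtration :: "(int \<Rightarrow> 'v set) \<Rightarrow> int \<Rightarrow> ('v \<times> 'v::real_vector) set" where
  "complexify_filtration W n = W n \<times> W n"

section \<open>Iterated graded pieces\<close>

text \<open>A subquotient \<open>A / B\<close> with \<open>B \<subseteq> A\<close> subspaces of the ambient space is represented by the pair
  \<open>(A, B)\<close>.  A filtration \<open>G\<close> of the ambient space induces on \<open>A / B\<close> the filtration by the
  subspaces \<open>(G p \<inter> A + B) / B\<close> (the images of the \<open>G p \<inter> A\<close>); \<open>induced G p (A, B)\<close> is the numerator.
  A graded piece of \<open>A / B\<close> is a quotient of two such subspaces, and is again represented by a pair of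
  subspaces of the ambient space (third isomorphism theorem), so the construction can be iterated.
  On sets, \<open>+\<close> is the elementwise (Minkowski) sum.\<close>

type_synonym 'a subquotient = "'a set \<times> 'a set"

definition induced :: "(int \<Rightarrow> 'a set) \<Rightarrow> int \<Rightarrow> 'a subquotient \<Rightarrow> 'a::plus set" where
  "induced G p X = (G p \<inter> fst X) + snd X"

definition Gr_decr :: "(int \<Rightarrow> 'a set) \<Rightarrow> int \<Rightarrow> 'a subquotient \<Rightarrow> 'a::plus subquotient" where
  "Gr_decr G p X = (induced G p X, induced G (p + 1) X)"

definition Gr_incr :: "(int \<Rightarrow> 'a set) \<Rightarrow> int \<Rightarrow> 'a subquotient \<Rightarrow> 'a::plus subquotient" where
  "Gr_incr G n X = (induced G n X, induced G (n - 1) X)"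

definition whole :: "'a::zero subquotient" where
  "whole = (UNIV, {0})"

definition is_zero_subquotient :: "'a subquotient \<Rightarrow> bool" where
  "is_zero_subquotient X \<longleftrightarrow> fst X = snd X"

text \<open>The complex dimension of \<open>A / B\<close>; the ambient space is finite-dimensional and \<open>B \<subseteq> A\<close> in
  all uses, so the subtraction does not truncate.\<close>

definition subquotient_dim :: "('v \<times> 'v::real_vector) subquotient \<Rightarrow> nat" where
  "subquotient_dim X = cplx.dim (fst X) - cplx.dim (snd X)"

section \<open>Real mixed Hodge structures\<close>

text \<open>Exhaustive filtrations are understood to reach both the whole space and \<open>0\<close> after finitely many
  steps, as usual for mixed Hodge structures and for Rees bundles.\<close>

definition exhaustive :: "(int \<Rightarrow> 'a::zero set) \<Rightarrow> bool" where
  "exhaustive G \<longleftrightarrow> (\<exists>n. G n = UNIV) \<and> (\<exists>n. G n = {0})"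

text \<open>The underlying real vector space is the type \<open>'v\<close>, which may be trivial.\<close>

locale real_mixed_hodge_structure =
  fixes W :: "int \<Rightarrow> 'v::real_vector set"
    and F :: "int \<Rightarrow> ('v \<times> 'v) set"
  assumes finite_dimensional: "\<exists>B :: 'v set. finite B \<and> span B = UNIV"
    and subspace_W: "subspace (W n)"
    and mono_W: "mono W"
    and exhaustive_W: "exhaustive W"
    and subspace_F: "cplx.subspace (F p)"
    and antimono_F: "antimono F"
    and exhaustive_F: "exhaustive F"
    and opposed: "p + q \<noteq> n \<Longrightarrow>
      is_zero_subquotient
        (Gr_decr F p (Gr_decr (conj_filtration F) q (Gr_incr (complexify_filtration W) n whole)))"

section \<open>Level of real splitting\<close>

definition hodge_number :: "(int \<Rightarrow> 'v set) \<Rightarrow> (int \<Rightarrow> ('v \<times> 'v::real_vector) set) \<Rightarrow> int \<Rightarrow> int \<Rightarrow> nat" where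
  "hodge_number W F p q = subquotient_dim
     (Gr_decr (conj_filtration F) q (Gr_decr F p (Gr_incr (complexify_filtration W) (p + q) whole)))"

definition s_number :: "(int \<Rightarrow> ('v \<times> 'v::real_vector) set) \<Rightarrow> int \<Rightarrow> int \<Rightarrow> nat" where
  "s_number F p q = subquotient_dim (Gr_decr F p (Gr_decr (conj_filtration F) q whole))"

text \<open>The sum has finite support; see \<open>finite_support\<close> below.\<close>

definition splitting_level :: "(int \<Rightarrow> 'v set) \<Rightarrow> (int \<Rightarrow> ('v \<times> 'v::real_vector) set) \<Rightarrow> real" where
  "splitting_level W F = 1 / 2 *
     (\<Sum>\<^sub>\<infinity>(p, q)\<in>UNIV. (of_int (p + q))\<^sup>2 * (real (hodge_number W F p q) - real (s_number F p q)))"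

section \<open>Deligne splitting and real-split structures\<close>

definition deligne_I ::
  "(int \<Rightarrow> 'v set) \<Rightarrow> (int \<Rightarrow> ('v \<times> 'v::real_vector) set) \<Rightarrow> int \<Rightarrow> int \<Rightarrow> ('v \<times> 'v) set" where
  "deligne_I W F p q =
     (let WC = complexify_filtration W; F' = conj_filtration F in
       (F p \<inter> WC (p + q)) \<inter>
       ((F' q \<inter> WC (p + q)) + cplx.span (\<Union>i\<in>{1..}. F' (q - i) \<inter> WC (p + q - i - 1))))"

definition R_split :: "(int \<Rightarrow> 'v set) \<Rightarrow> (int \<Rightarrow> ('v \<times> 'v::real_vector) set) \<Rightarrow> bool" where
  "R_split W F \<longleftrightarrow> (\<forall>p q. deligne_I W F p q = cconj ` deligne_I W F q p)"

section \<open>Finiteness of the sum\<close>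

lemma subspace_conj_image: "cplx.subspace A \<Longrightarrow> cplx.subspace (cconj ` A)"
proof -
  assume A: "cplx.subspace A"
  have 1: "cconj (x + y) = cconj x + cconj y" for x y :: "'a \<times> 'a"
    by (auto simp: cconj_def)
  have 2: "cscale c (cconj x) = cconj (cscale (cnj c) x)" for c and x :: "'a \<times> 'a"
    by (auto simp: cconj_def cscale_def)
  have 3: "cconj 0 = (0 :: 'a \<times> 'a)"
    by (auto simp: cconj_def zero_prod_def)
  show ?thesis
    using A unfolding cplx.subspace_def by (auto simp: 1[symmetric] 2 image_iff) (metis 3)
qed

lemma subspace_set_plus:
  assumes "cplx.subspace A" "cplx.subspace B"
  shows "cplx.subspace (A + B)"
proof -
  have "A + B = {x + y |x y. x \<in> A \<and> y \<in> B}"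
    unfolding set_plus_def by blast
  then show ?thesis
    using cplx.subspace_sums[OF assms] by simp
qed

lemma set_plus_absorb:
  assumes "cplx.subspace A" "cplx.subspace C"
  shows "(A \<inter> C) + C = C"
proof
  show "(A \<inter> C) + C \<subseteq> C"
    using cplx.subspace_add[OF assms(2)] unfolding set_plus_def by blast
  show "C \<subseteq> (A \<inter> C) + C"
  proof
    fix x assume "x \<in> C"
    then have "0 + x \<in> (A \<inter> C) + C"
      using assms by (intro set_plus_intro) (auto simp: cplx.subspace_0)
    then show "x \<in> (A \<inter> C) + C" by simp
  qed
qed

lemma subspace_induced:
  assumes "\<And>p. cplx.subspace (G p)" "cplx.subspace (fst X)" "cplx.subspace (snd X)"
  shows "cplx.subspace (induced G p X)"
  unfolding induced_def using assms by (intro subspace_set_plus cplx.subspace_inter)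

lemma finite_steps:
  assumes "antimono (G :: int \<Rightarrow> 'a::zero set)" "exhaustive G" "\<And>p. 0 \<in> G p"
  shows "finite {p. G p \<noteq> G (p + 1)}"
proof -
  obtain a b where a: "G a = UNIV" and b: "G b = {0}"
    using assms(2) by (auto simp: exhaustive_def)
  have lo: "G p = UNIV" if "p \<le> a" for p
    using antimonoD[OF assms(1) that] a by auto
  have hi: "G p = {0}" if "p \<ge> b" for p
    using antimonoD[OF assms(1) that] b assms(3)[of p] by auto
  have "p \<in> {a..b}" if "G p \<noteq> G (p + 1)" for p
    using that lo[of p] lo[of "p + 1"] hi[of p] hi[of "p + 1"] by force
  then show ?thesis
    by (intro finite_subset[OF _ finite_atLeastAtMost_int[of a b]]) blast
qed

lemma subquotient_dim_Gr_Gr_nonzero: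
  assumes G: "\<And>p. cplx.subspace (G p)" and H: "\<And>p. cplx.subspace (H p)"
    and X: "cplx.subspace (fst X)" "cplx.subspace (snd X)"
    and "subquotient_dim (Gr_decr G p (Gr_decr H q X)) \<noteq> 0"
  shows "G p \<noteq> G (p + 1) \<and> H q \<noteq> H (q + 1)"
proof -
  have "H q \<noteq> H (q + 1)"
  proof
    assume "H q = H (q + 1)"
    then have eq: "induced H (q + 1) X = induced H q X"
      by (simp add: induced_def)
    have "cplx.subspace (induced H q X)"
      by (rule subspace_induced[OF H X])
    then have "induced G r (Gr_decr H q X) = induced H q X" for r
      using set_plus_absorb[OF G, of "induced H q X" r] eq
      by (simp add: Gr_decr_def induced_def[of G])
    then have "Gr_decr G p (Gr_decr H q X) = (induced H q X, induced H q X)"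
      by (simp add: Gr_decr_def[of G])
    then show False
      using assms(5) by (simp add: subquotient_dim_def)
  qed
  moreover have "G p \<noteq> G (p + 1)"
    using assms(5) by (auto simp: subquotient_dim_def Gr_decr_def[of G] induced_def[of G])
  ultimately show ?thesis by simp
qed

context real_mixed_hodge_structure
begin

lemma subspace_conj_filtration: "cplx.subspace (conj_filtration F p)"
  unfolding conj_filtration_def by (rule subspace_conj_image[OF subspace_F])

lemma subspace_complexify_filtration: "cplx.subspace (complexify_filtration W n)"
  using subspace_W[of n]
  by (auto simp: cplx.subspace_def complexify_filtration_def cscale_def zero_prod_def
      real_vector.subspace_0 real_vector.subspace_add real_vector.subspace_diff
      real_vector.subspace_scale)

lemma finite_support:
  "finite {(p, q). hodge_number W F p q \<noteq> 0 \<or> s_number F p q \<noteq> 0}"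
proof -
  let ?S = "{p. F p \<noteq> F (p + 1)}"
  have fin: "finite ?S"
    by (rule finite_steps[OF antimono_F exhaustive_F cplx.subspace_0[OF subspace_F]])
  have step: "F q \<noteq> F (q + 1)" if "conj_filtration F q \<noteq> conj_filtration F (q + 1)" for q
    using that by (auto simp: conj_filtration_def)
  have whole: "cplx.subspace (fst whole)" "cplx.subspace (snd whole)"
    by (auto simp: whole_def)
  have GrW: "cplx.subspace (fst (Gr_incr (complexify_filtration W) n whole))"
    "cplx.subspace (snd (Gr_incr (complexify_filtration W) n whole))" for n
    using subspace_induced[where G = "complexify_filtration W", OF subspace_complexify_filtration whole]
    by (simp_all add: Gr_incr_def)
  have "p \<in> ?S \<and> q \<in> ?S" if "hodge_number W F p q \<noteq> 0" for p q
    using subquotient_dim_Gr_Gr_nonzero[where G = "conj_filtration F" and H = F,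
        OF subspace_conj_filtration subspace_F GrW that[unfolded hodge_number_def]] step
    by auto
  moreover have "p \<in> ?S \<and> q \<in> ?S" if "s_number F p q \<noteq> 0" for p q
    using subquotient_dim_Gr_Gr_nonzero[where G = F and H = "conj_filtration F",
        OF subspace_F subspace_conj_filtration whole that[unfolded s_number_def]] step
    by auto
  ultimately show ?thesis
    by (intro finite_subset[OF _ finite_cartesian_product[OF fin fin]]) blast
qed

end

end

theory Submission
  imports Defs
begin

text \<open>The level is a sum of non-negative integers, one for each pair \<open>(p, q)\<close>. Put
  \<open>f(p, q) = dim (F\<^sup>p \<inter> F'\<^sup>q)\<close> and let \<open>g(p, q)\<close> be the sum over \<open>n\<close> of the dimensions of the
  intersection of the filtrations that \<open>F\<^sup>p\<close> and \<open>F'\<^sup>q\<close> induce on the \<open>n\<close>-th graded piece of \<open>W\<close>.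
  Then \<open>h - s\<close> is the mixed second difference of \<open>g - f\<close>; as \<open>(p + q)\<^sup>2\<close> has mixed second difference
  \<open>2\<close>, summation by parts gives \<open>\<alpha>(H) = \<Sum> (g(p, q) - f(p, q))\<close>. Now \<open>g - f\<close> is the total defect of
  the maps from the \<open>W\<close>-graded pieces of \<open>F\<^sup>p \<inter> F'\<^sup>q\<close> to the intersections on the graded pieces.
  So \<open>\<alpha>(H) = 0\<close> if and only if all these maps are surjective, and since Deligne's \<open>I\<^sup>p\<^sup>,\<^sup>q\<close> maps
  bijectively onto the Hodge component of type \<open>(p, q)\<close>, this means that
  \<open>I\<^sup>p\<^sup>,\<^sup>q = F\<^sup>p \<inter> F'\<^sup>q \<inter> W\<^sub>p\<^sub>+\<^sub>q\<close> for all \<open>p\<close>, \<open>q\<close>, which is the same as \<open>R\<close>-splitness.\<close>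

section \<open>Linear algebra in the complexification\<close>

lemma set_plus_subset_subspace:
  assumes "cplx.subspace C" "A \<subseteq> C" "B \<subseteq> C"
  shows "A + B \<subseteq> C"
  using assms cplx.subspace_add[OF assms(1)] unfolding set_plus_def by blast

lemma subset_set_plus:
  assumes "cplx.subspace A" "cplx.subspace B"
  shows "A \<subseteq> A + B" "B \<subseteq> A + B"
  using set_plus_mono2[of A A "{0}" B] set_plus_mono2[of "{0}" A B B] assms
  by (auto simp: cplx.subspace_0)

lemma cconj_cconj [simp]: "cconj (cconj x) = x"
  by (simp add: cconj_def)

lemma cconj_image_cconj_image [simp]: "cconj ` cconj ` A = A"
  by (simp add: image_image)

lemma cconj_image_Int: "cconj ` (A \<inter> B) = cconj ` A \<inter> cconj ` B"
  by (intro image_Int inj_on_inverseI[where g = cconj]) simp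

lemma cplx_span_embedding:
  fixes S :: "'v::real_vector set"
  assumes "span S = UNIV"
  shows "cplx.span ((\<lambda>b. (b, 0)) ` S) = UNIV"
proof -
  let ?T = "cplx.span ((\<lambda>b. (b, 0)) ` S)"
  have *: "(x, 0) \<in> ?T" for x
  proof -
    have "x \<in> span S" using assms by simp
    then show ?thesis
    proof (induction rule: span_induct_alt)
      case base
      then show ?case using cplx.span_zero by (simp add: zero_prod_def)
    next
      case (step c x y)
      have "(c *\<^sub>R x + y, 0) = cscale (of_real c) (x, 0) + (y, 0)"
        by (simp add: cscale_def)
      also have "\<dots> \<in> ?T"
        using step by (intro cplx.span_add cplx.span_scale) (auto intro: cplx.span_base)
      finally show ?case .
    qed
  qed
  have "v \<in> ?T" for v
  proof -
    have "v = (fst v, 0) + cscale \<i> (snd v, 0)"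
      by (simp add: cscale_def)
    also have "\<dots> \<in> ?T"
      by (intro cplx.span_add cplx.span_scale *)
    finally show ?thesis .
  qed
  then show ?thesis by blast
qed

text \<open>Phrased as the locale predicate, so that the dimension formulas below can interpret it
  inside their proofs.\<close>

lemma finite_dimensional_complexification:
  fixes S :: "'v::real_vector set"
  assumes "finite S" "span S = UNIV"
  shows "\<exists>B :: ('v \<times> 'v) set. finite_dimensional_vector_space cscale B"
proof -
  let ?T = "(\<lambda>b. (b, 0)) ` S :: ('v \<times> 'v) set"
  obtain B where B: "B \<subseteq> ?T" "cplx.independent B" "?T \<subseteq> cplx.span B"
    using cplx.maximal_independent_subset by blast
  have "cplx.span B = UNIV"
    using cplx.span_mono[OF B(3)] cplx_span_embedding[OF assms(2)] by (auto simp: cplx.span_span)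
  moreover have "finite B"
    using B(1) assms(1) finite_subset by blast
  ultimately have "finite_dimensional_vector_space cscale B"
    using B(2) by unfold_locales auto
  then show ?thesis by blast
qed

section \<open>Induced filtrations on the weight graded pieces\<close>

context real_mixed_hodge_structure
begin

abbreviation "WC \<equiv> complexify_filtration W"
abbreviation "F' \<equiv> conj_filtration F"
abbreviation "grF n p \<equiv> induced F p (Gr_incr WC n whole)"
abbreviation "grF' n q \<equiv> induced F' q (Gr_incr WC n whole)"

lemma cplx_finite_dimensional: "\<exists>B :: ('v \<times> 'v) set. finite_dimensional_vector_space cscale B"
  using finite_dimensional finite_dimensional_complexification by blast

lemma dim_set_plus:
  fixes A C :: "('v \<times> 'v) set"
  assumes "cplx.subspace A" "cplx.subspace C"
  shows "cplx.dim (A + C) + cplx.dim (A \<inter> C) = cplx.dim A + cplx.dim C"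
proof -
  obtain B :: "('v \<times> 'v) set" where "finite_dimensional_vector_space cscale B"
    using cplx_finite_dimensional by blast
  then interpret fd: finite_dimensional_vector_space "cscale :: complex \<Rightarrow> 'v \<times> 'v \<Rightarrow> 'v \<times> 'v" B .
  have "A + C = {x + y |x y. x \<in> A \<and> y \<in> C}"
    unfolding set_plus_def by blast
  then show ?thesis
    using fd.dim_sums_Int[OF assms] by simp
qed

lemma dim_mono:
  fixes A C :: "('v \<times> 'v) set"
  assumes "A \<subseteq> C"
  shows "cplx.dim A \<le> cplx.dim C"
proof -
  obtain B :: "('v \<times> 'v) set" where "finite_dimensional_vector_space cscale B"
    using cplx_finite_dimensional by blast
  then interpret fd: finite_dimensional_vector_space "cscale :: complex \<Rightarrow> 'v \<times> 'v \<Rightarrow> 'v \<times> 'v" B .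
  show ?thesis using fd.dim_subset[OF assms] .
qed

lemma subspace_dim_equal:
  fixes A C :: "('v \<times> 'v) set"
  assumes "cplx.subspace A" "cplx.subspace C" "A \<subseteq> C" "cplx.dim C \<le> cplx.dim A"
  shows "A = C"
proof -
  obtain B :: "('v \<times> 'v) set" where "finite_dimensional_vector_space cscale B"
    using cplx_finite_dimensional by blast
  then interpret fd: finite_dimensional_vector_space "cscale :: complex \<Rightarrow> 'v \<times> 'v \<Rightarrow> 'v \<times> 'v" B .
  show ?thesis using fd.subspace_dim_equal[OF assms] .
qed

lemmas subspaces = subspace_F subspace_conj_filtration subspace_complexify_filtration

lemma mono_WC: "m \<le> n \<Longrightarrow> WC m \<subseteq> WC n"
  using monoD[OF mono_W] by (fastforce simp: complexify_filtration_def)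

lemma F_antimono: "p \<le> q \<Longrightarrow> F q \<subseteq> F p"
  using antimonoD[OF antimono_F] .

lemma F'_antimono: "p \<le> q \<Longrightarrow> F' q \<subseteq> F' p"
  using F_antimono by (auto simp: conj_filtration_def)

lemma F_bounds:
  obtains a b where "\<And>p. p \<le> a \<Longrightarrow> F p = UNIV" "\<And>p. p \<le> a \<Longrightarrow> F' p = UNIV"
    "\<And>p. p \<ge> b \<Longrightarrow> F p = {0}" "\<And>p. p \<ge> b \<Longrightarrow> F' p = {0}"
proof -
  obtain a b where ab: "F a = UNIV" "F b = {0}"
    using exhaustive_F by (auto simp: exhaustive_def)
  have surj: "range cconj = (UNIV :: ('v \<times> 'v) set)"
    by (metis cconj_cconj surjI)
  have 1: "F p = UNIV" if "p \<le> a" for p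
    using F_antimono[OF that] ab by auto
  have 2: "F p = {0}" if "p \<ge> b" for p
    using F_antimono[OF that] ab cplx.subspace_0[OF subspace_F[of p]] by auto
  show ?thesis
    using 1 2 surj by (intro that[of a b]) (auto simp: conj_filtration_def cconj_def zero_prod_def)
qed

lemma WC_bounds:
  obtains c d where "c \<le> d" "\<And>n. n \<le> c \<Longrightarrow> WC n = {0}" "\<And>n. n \<ge> d \<Longrightarrow> WC n = UNIV"
proof -
  obtain c d where cd: "W c = {0}" "W d = UNIV"
    using exhaustive_W by (auto simp: exhaustive_def)
  have "WC c = {0}" "WC d = UNIV"
    using cd by (auto simp: complexify_filtration_def zero_prod_def)
  then have "WC n = {0}" if "n \<le> c" for n
    using mono_WC[OF that] cplx.subspace_0[OF subspace_complexify_filtration[of n]] by auto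
  moreover have "WC n = UNIV" if "n \<ge> max c d" for n
    using mono_WC[of d n] that \<open>WC d = UNIV\<close> by auto
  ultimately show ?thesis
    by (intro that[of c "max c d"]) auto
qed

lemma Gr_W_eq: "Gr_incr WC n whole = (WC n, WC (n - 1))"
  by (simp add: Gr_incr_def whole_def induced_def)

lemma grF_eq: "grF n p = F p \<inter> WC n + WC (n - 1)"
  by (simp add: induced_def Gr_W_eq)

lemma grF'_eq: "grF' n q = F' q \<inter> WC n + WC (n - 1)"
  by (simp add: induced_def Gr_W_eq)

lemma subspace_gr: "cplx.subspace (grF n p)" "cplx.subspace (grF' n q)"
  unfolding grF_eq grF'_eq by (intro subspace_set_plus cplx.subspace_inter subspaces)+

lemma gr_le: "grF n p \<subseteq> WC n" "grF' n q \<subseteq> WC n"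
  unfolding grF_eq grF'_eq
  by (intro set_plus_subset_subspace subspaces; use mono_WC[of "n-1" n] in auto)+

lemma gr_ge: "WC (n - 1) \<subseteq> grF n p" "WC (n - 1) \<subseteq> grF' n q"
  unfolding grF_eq grF'_eq by (intro subset_set_plus cplx.subspace_inter subspaces)+

lemma le_gr: "F p \<inter> WC n \<subseteq> grF n p" "F' q \<inter> WC n \<subseteq> grF' n q"
  unfolding grF_eq grF'_eq by (intro subset_set_plus cplx.subspace_inter subspaces)+

text \<open>Modulo \<open>WC (n - 1)\<close>, \<open>x\<close> is represented by \<open>f\<close> in
  \<open>F p\<close>. Opposedness kills the graded piece of type \<open>(p, q)\<close>, so
  \<open>f\<close> splits into \<open>y\<close> in \<open>F (p + 1)\<close> and \<open>z\<close> in
  the next step of \<open>F'\<close>. The remainder \<open>x - y\<close> stays in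
  \<open>grF n p\<close>, since \<open>y\<close> lies there.\<close>

lemma gr_step:
  assumes "p + q \<noteq> n"
  shows "grF n p \<inter> grF' n q \<subseteq> grF n (p + 1) \<inter> grF' n q + grF n p \<inter> grF' n (q + 1)"
proof
  fix x assume x: "x \<in> grF n p \<inter> grF' n q"
  have eq: "F p \<inter> grF' n q + grF' n (q + 1) = F (p + 1) \<inter> grF' n q + grF' n (q + 1)"
    using opposed[OF assms] by (simp add: is_zero_subquotient_def Gr_decr_def induced_def[of F])
  obtain f w where fw: "x = f + w" "f \<in> F p \<inter> WC n" "w \<in> WC (n - 1)"
    using x unfolding grF_eq by (auto elim!: set_plus_elim)
  have "f = x - w" using fw by simp
  then have "f \<in> grF' n q"
    using cplx.subspace_diff[OF subspace_gr(2), of x q n w] x fw(3) gr_ge(2)[of n q] by auto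
  then have "f \<in> F p \<inter> grF' n q + grF' n (q + 1)"
    using subset_set_plus(1)[OF cplx.subspace_inter[OF subspace_F subspace_gr(2)] subspace_gr(2)]
      fw(2) by (meson IntD1 IntI subsetD)
  then obtain y z where yz: "f = y + z" "y \<in> F (p + 1) \<inter> grF' n q" "z \<in> grF' n (q + 1)"
    unfolding eq by (auto elim!: set_plus_elim)
  have y: "y \<in> grF n (p + 1)" using yz gr_le(2)[of q n] le_gr(1)[of "p + 1" n] by auto
  have "z + w = x - y" using fw yz by simp
  moreover have "y \<in> grF n p"
    using yz F_antimono[of p "p + 1"] gr_le(2)[of q n] le_gr(1)[of p n] by auto
  ultimately have "z + w \<in> grF n p"
    using x cplx.subspace_diff[OF subspace_gr(1), of x p n y] by simp
  moreover have "z + w \<in> grF' n (q + 1)"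
    by (rule cplx.subspace_add[OF subspace_gr(2) yz(3) subsetD[OF gr_ge(2) fw(3)]])
  moreover have "x = y + (z + w)" using fw yz by simp
  ultimately show "x \<in> grF n (p + 1) \<inter> grF' n q + grF n p \<inter> grF' n (q + 1)"
    using y yz by auto
qed

text \<open>Every intersection of induced filtrations is generated by the Hodge components it contains. Applied
  to suitable \<open>L\<close>, this gives the vanishing for \<open>p + q > n\<close> as well as the generation of the whole
  graded piece for \<open>p + q = n + 1\<close>.\<close>

lemma gr_generate:
  assumes L: "cplx.subspace L" "WC (n - 1) \<subseteq> L"
    and "\<And>a b. p \<le> a \<Longrightarrow> q \<le> b \<Longrightarrow> a + b = n \<Longrightarrow> grF n a \<inter> grF' n b \<subseteq> L"
  shows "grF n p \<inter> grF' n q \<subseteq> L"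
proof -
  obtain c where c: "\<And>p. p \<ge> c \<Longrightarrow> F p = {0}" "\<And>p. p \<ge> c \<Longrightarrow> F' p = {0}"
    by (rule F_bounds) blast
  have "0 \<in> WC m" for m
    by (rule cplx.subspace_0[OF subspace_complexify_filtration])
  then have zero: "{0} \<inter> WC m + WC (m - 1) = WC (m - 1)" for m
    by (simp add: Int_absorb2 Int_absorb1)
  \<comment> \<open>Both filtrations vanish from \<open>c\<close> on, which ends the recursion at
    \<open>WC (n - 1)\<close>. When both indices are below \<open>c\<close> the measure is positive,
    and \<open>gr_step\<close> raises one index unless \<open>p + q = n\<close>.\<close>
  show ?thesis using assms(3)
  proof (induction "nat (2 * c - p - q)" arbitrary: p q rule: less_induct)
    case less
    consider "p \<ge> c" | "q \<ge> c" | "p + q = n" | "p < c" "q < c" "p + q \<noteq> n" by linarith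
    then show ?case
    proof cases
      case 1
      then have "grF n p = WC (n - 1)" unfolding grF_eq by (simp only: c zero)
      then show ?thesis using L by auto
    next
      case 2
      then have "grF' n q = WC (n - 1)" unfolding grF'_eq by (simp only: c zero)
      then show ?thesis using L by auto
    next
      case 3
      then show ?thesis using less.prems by auto
    next
      case 4
      have lt: "nat (2 * c - (p + 1) - q) < nat (2 * c - p - q)"
        "nat (2 * c - p - (q + 1)) < nat (2 * c - p - q)"
        using 4 by linarith+
      have "grF n (p + 1) \<inter> grF' n q \<subseteq> L"
        by (rule less.hyps[OF lt(1)], rule less.prems) linarith+
      moreover have "grF n p \<inter> grF' n (q + 1) \<subseteq> L"
        by (rule less.hyps[OF lt(2)], rule less.prems) linarith+
      ultimately show ?thesis
        by (rule order.trans[OF gr_step[OF 4(3)] set_plus_subset_subspace[OF L(1)]])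
    qed
  qed
qed

text \<open>No pair \<open>(a, b)\<close> with \<open>a + b = n\<close> dominates
  \<open>(p, q)\<close>, so the condition on components is vacuous.\<close>

lemma gr_vanish: "p + q > n \<Longrightarrow> grF n p \<inter> grF' n q \<subseteq> WC (n - 1)"
  by (rule gr_generate[OF subspace_complexify_filtration order.refl]) linarith

text \<open>A component of type \<open>(i, j)\<close> with \<open>i + j = n = p + q - 1\<close> has
  \<open>i \<ge> p\<close> or \<open>j \<ge> q\<close>, hence lies in one of the summands.\<close>

lemma gr_sum:
  assumes "p + q = n + 1"
  shows "WC n \<subseteq> grF n p + grF' n q"
proof -
  obtain a where a: "F a = UNIV" "F' a = UNIV"
    by (rule F_bounds) blast
  have "WC n = grF n a \<inter> grF' n a"
    using gr_le[of a n] le_gr[of a n] unfolding a Int_UNIV_left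
    by (intro equalityI Int_greatest) blast+
  also have "\<dots> \<subseteq> grF n p + grF' n q"
  proof (rule gr_generate)
    show "cplx.subspace (grF n p + grF' n q)"
      by (intro subspace_set_plus subspace_gr)
    have le: "grF n p \<subseteq> grF n p + grF' n q" "grF' n q \<subseteq> grF n p + grF' n q"
      by (intro subset_set_plus subspace_gr)+
    then show "WC (n - 1) \<subseteq> grF n p + grF' n q"
      using gr_ge by blast
    fix i j assume "i + j = n"
    then consider "i \<ge> p" | "j \<ge> q" using assms by linarith
    then show "grF n i \<inter> grF' n j \<subseteq> grF n p + grF' n q"
    proof cases
      case 1
      have "grF n i \<subseteq> grF n p"
        unfolding grF_eq using F_antimono[OF 1] by (intro set_plus_mono2) auto
      then show ?thesis using le by blast
    next
      case 2
      have "grF' n j \<subseteq> grF' n q"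
        unfolding grF'_eq using F'_antimono[OF 2] by (intro set_plus_mono2) auto
      then show ?thesis using le by blast
    qed
  qed
  finally show ?thesis .
qed

section \<open>Deligne's subspaces\<close>

lemma deligne_I_le: "deligne_I W F p q \<subseteq> F p \<inter> WC (p + q)"
  unfolding deligne_I_def Let_def by (rule Int_lower1)

text \<open>Cut the sum at index \<open>k\<close>: the terms with \<open>i \<le> k\<close> lie in
  \<open>F' (q - k)\<close>, the later ones have weight at most
  \<open>p + q - k - 2\<close>.\<close>

lemma deligne_I_subset:
  assumes "k \<ge> 0"
  shows "deligne_I W F p q \<subseteq> F' (q - k) + WC (p + q - k - 2)"
proof -
  let ?S = "F' (q - k) + WC (p + q - k - 2)"
  have S: "cplx.subspace ?S" by (intro subspace_set_plus subspaces)
  have le: "F' (q - k) \<subseteq> ?S" "WC (p + q - k - 2) \<subseteq> ?S"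
    by (intro subset_set_plus subspaces)+
  have "F' (q - i) \<inter> WC (p + q - i - 1) \<subseteq> ?S" for i
  proof (cases "i \<le> k")
    case True
    then show ?thesis using F'_antimono[of "q - k" "q - i"] le by auto
  next
    case False
    then show ?thesis using mono_WC[of "p + q - i - 1" "p + q - k - 2"] le by auto
  qed
  then have "cplx.span (\<Union>i\<in>{1..}. F' (q - i) \<inter> WC (p + q - i - 1)) \<subseteq> ?S"
    using S by (intro cplx.span_minimal) auto
  moreover have "F' q \<inter> WC (p + q) \<subseteq> ?S"
    using F'_antimono[of "q - k" q] le assms by auto
  ultimately show ?thesis
    using set_plus_subset_subspace[OF S] unfolding deligne_I_def Let_def by blast
qed

text \<open>Such an element sinks through the weight filtration. In weight
  \<open>m = p + q - 1 - k\<close> it lies in \<open>F p\<close> and, modulo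
  \<open>WC (m - 1)\<close>, in \<open>F' (q - k)\<close>; these indices add up to
  \<open>m + 1\<close>, so \<open>gr_vanish\<close> pushes it one step down.\<close>

lemma deligne_I_inj:
  assumes x: "x \<in> deligne_I W F p q" "x \<in> WC (p + q - 1)"
  shows "x = 0"
proof -
  have "x \<in> WC (p + q - 1 - int k)" for k
  proof (induction k)
    case 0
    then show ?case using x by simp
  next
    case (Suc k)
    let ?m = "p + q - 1 - int k"
    have "x \<in> F p" using x by (simp add: deligne_I_def Let_def)
    then have "x \<in> grF ?m p" using Suc le_gr by blast
    have e: "p + q - int k - 2 = ?m - 1" by simp
    have "x \<in> F' (q - int k) + WC (?m - 1)"
      using deligne_I_subset[of "int k" p q] x(1) unfolding e by auto
    then obtain u w where uw: "x = u + w" "u \<in> F' (q - int k)" "w \<in> WC (?m - 1)"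
      by (auto elim!: set_plus_elim)
    have "u = x - w" using uw by simp
    then have "u \<in> WC ?m"
      using Suc uw(3) mono_WC[of "?m - 1" ?m]
        cplx.subspace_diff[OF subspace_complexify_filtration, of x ?m w] by auto
    then have "x \<in> grF' ?m (q - int k)"
      using uw unfolding grF'_eq by auto
    with \<open>x \<in> grF ?m p\<close> have "x \<in> WC (?m - 1)"
      using gr_vanish[of ?m p "q - int k"] by auto
    moreover have "?m - 1 = p + q - 1 - int (Suc k)" by simp
    ultimately show ?case by simp
  qed
  moreover obtain c where c: "\<And>n. n \<le> c \<Longrightarrow> WC n = {0}"
    by (rule WC_bounds) blast
  ultimately show ?thesis
    using c[of "p + q - 1 - int (nat (p + q - 1 - c))"] by fastforce
qed

text \<open>Representatives \<open>f\<close> in \<open>F p\<close> and \<open>u\<close> in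
  \<open>F' q\<close> of the same class differ by an element of lower weight. It splits into a part
  \<open>a\<close> in \<open>F p\<close>, which corrects \<open>f\<close>, and a part in
  \<open>?T\<close>, which puts \<open>f - a\<close> into \<open>deligne_I W F p q\<close>.\<close>

lemma deligne_I_surj:
  "grF (p + q) p \<inter> grF' (p + q) q \<subseteq> deligne_I W F p q + WC (p + q - 1)"
proof
  let ?n = "p + q"
  let ?U = "\<Union>i\<in>{1..}. F' (q - i) \<inter> WC (?n - i - 1)"
  let ?T = "F' q \<inter> WC ?n + cplx.span ?U"
  have T: "cplx.subspace ?T"
    by (intro subspace_set_plus cplx.subspace_inter subspaces cplx.subspace_span)
  have leT: "F' q \<inter> WC ?n \<subseteq> ?T" "cplx.span ?U \<subseteq> ?T"
    by (intro subset_set_plus cplx.subspace_inter subspaces cplx.subspace_span)+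
  obtain c where c: "\<And>n. n \<le> c \<Longrightarrow> WC n = {0}"
    by (rule WC_bounds) blast
  \<comment> \<open>Climbing down the weight filtration, the \<open>F'\<close>-part of \<open>WC m\<close> that complements \<open>F p\<close> has exactly
    the index that occurs in the sum defining \<open>deligne_I\<close>.\<close>
  have absorb: "WC m \<subseteq> F p \<inter> WC m + ?T" if "m \<le> ?n - 1" for m
    using that
  proof (induction "nat (m - c)" arbitrary: m rule: less_induct)
    case less
    have sub: "cplx.subspace (F p \<inter> WC m + ?T)"
      by (intro subspace_set_plus cplx.subspace_inter subspaces T)
    have le: "F p \<inter> WC m \<subseteq> F p \<inter> WC m + ?T" "?T \<subseteq> F p \<inter> WC m + ?T"
      by (intro subset_set_plus cplx.subspace_inter subspaces T)+
    show ?case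
    proof (cases "m \<le> c")
      case True
      then show ?thesis using c cplx.subspace_0[OF sub] by auto
    next
      case False
      have "WC (m - 1) \<subseteq> F p \<inter> WC (m - 1) + ?T"
        using False less.prems by (intro less.hyps) auto
      also have "\<dots> \<subseteq> F p \<inter> WC m + ?T"
        using mono_WC[of "m - 1" m] by (intro set_plus_mono2) auto
      finally have lower: "WC (m - 1) \<subseteq> F p \<inter> WC m + ?T" .
      \<comment> \<open>The top weight \<open>m = ?n - 1\<close> corresponds to
        \<open>i = 0\<close>, which the sum leaves out; there \<open>m + 1 - p = q\<close> and the
        first summand of \<open>?T\<close> takes over.\<close>
      have "F' (m + 1 - p) \<inter> WC m \<subseteq> ?T"
      proof (cases "m = ?n - 1")
        case True
        then show ?thesis using leT(1) mono_WC[of m ?n] by auto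
      next
        case neq: False
        define i where "i = ?n - 1 - m"
        have i: "i \<ge> 1" "m + 1 - p = q - i" "m = ?n - i - 1"
          using neq less.prems by (auto simp: i_def)
        have "F' (q - i) \<inter> WC (?n - i - 1) \<subseteq> ?U"
          using i(1) by (intro UN_upper) simp
        then show ?thesis
          using leT(2) cplx.span_superset[of ?U] unfolding i(2) i(3)[symmetric] by blast
      qed
      then have "grF' m (m + 1 - p) \<subseteq> F p \<inter> WC m + ?T"
        unfolding grF'_eq using lower le by (intro set_plus_subset_subspace[OF sub]) auto
      moreover have "grF m p \<subseteq> F p \<inter> WC m + ?T"
        unfolding grF_eq using lower le by (intro set_plus_subset_subspace[OF sub]) auto
      ultimately have "grF m p + grF' m (m + 1 - p) \<subseteq> F p \<inter> WC m + ?T"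
        by (intro set_plus_subset_subspace[OF sub])
      then show ?thesis
        using gr_sum[of p "m + 1 - p" m] by simp
    qed
  qed
  fix x assume x: "x \<in> grF ?n p \<inter> grF' ?n q"
  obtain f w where fw: "x = f + w" "f \<in> F p \<inter> WC ?n" "w \<in> WC (?n - 1)"
    using x unfolding grF_eq by (auto elim!: set_plus_elim)
  obtain u v where uv: "x = u + v" "u \<in> F' q \<inter> WC ?n" "v \<in> WC (?n - 1)"
    using x unfolding grF'_eq by (auto elim!: set_plus_elim)
  have "v - w \<in> WC (?n - 1)"
    using fw uv cplx.subspace_diff[OF subspace_complexify_filtration] by blast
  then obtain a t where at: "v - w = a + t" "a \<in> F p \<inter> WC (?n - 1)" "t \<in> ?T"
    using absorb[of "?n - 1"] by (meson order.refl set_plus_elim subsetD)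
  have "f - a = u + t"
    using fw(1) uv(1) at(1) by (simp add: algebra_simps)
  moreover have "u + t \<in> ?T" using uv leT at cplx.subspace_add[OF T] by blast
  moreover have "f - a \<in> F p \<inter> WC ?n"
    using fw at mono_WC[of "?n - 1" ?n]
      cplx.subspace_diff[OF cplx.subspace_inter, OF subspaces(1) subspaces(3), of f p ?n a] by auto
  ultimately have "f - a \<in> deligne_I W F p q"
    by (simp add: deligne_I_def Let_def)
  moreover have "a + w \<in> WC (?n - 1)"
    using at fw cplx.subspace_add[OF subspace_complexify_filtration] by blast
  moreover have "x = (f - a) + (a + w)" using fw by simp
  ultimately show "x \<in> deligne_I W F p q + WC (?n - 1)" by blast
qed

text \<open>The preimage in \<open>WC n\<close> of the classes modulo \<open>WC (n - 1)\<close> with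
  one representative in both filtrations; in \<open>grF n p \<inter> grF' n q\<close> the two
  representatives may differ.\<close>

definition bigraded_lift :: "int \<Rightarrow> int \<Rightarrow> int \<Rightarrow> ('v \<times> 'v) set" where
  "bigraded_lift n p q = F p \<inter> F' q \<inter> WC n + WC (n - 1)"

lemma subspace_bigraded_lift: "cplx.subspace (bigraded_lift n p q)"
  unfolding bigraded_lift_def by (intro subspace_set_plus cplx.subspace_inter subspaces)

lemma bigraded_lift_subset: "bigraded_lift n p q \<subseteq> grF n p \<inter> grF' n q"
  unfolding bigraded_lift_def grF_eq grF'_eq
  by (rule Int_greatest; rule set_plus_mono2[OF _ order.refl]; blast)

text \<open>Splitness puts \<open>deligne_I W F a b\<close> into both filtrations, so every Hodge
  component lifts, and by \<open>gr_generate\<close> every intersection does. Conversely, lifting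
  forces \<open>deligne_I W F p q\<close> to be the intersection of \<open>F p\<close>,
  \<open>F' q\<close> and \<open>WC (p + q)\<close>, whose form is symmetric under
  conjugation.\<close>

lemma R_split_iff: "R_split W F \<longleftrightarrow> (\<forall>n p q. bigraded_lift n p q = grF n p \<inter> grF' n q)"
proof
  assume split: "R_split W F"
  have I: "deligne_I W F a b \<subseteq> F a \<inter> F' b \<inter> WC (a + b)" for a b
  proof -
    have "deligne_I W F a b = cconj ` deligne_I W F b a"
      using split unfolding R_split_def by blast
    also have "\<dots> \<subseteq> F' b"
      unfolding conj_filtration_def
      by (rule image_mono[OF order.trans[OF deligne_I_le Int_lower1]])
    finally show ?thesis using deligne_I_le[of a b] by blast
  qed
  have "grF n p \<inter> grF' n q \<subseteq> bigraded_lift n p q" for n p q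
  proof (rule gr_generate[OF subspace_bigraded_lift])
    show "WC (n - 1) \<subseteq> bigraded_lift n p q"
      unfolding bigraded_lift_def by (intro subset_set_plus cplx.subspace_inter subspaces)
    fix a b assume ab: "p \<le> a" "q \<le> b" "a + b = n"
    have "grF n a \<inter> grF' n b \<subseteq> deligne_I W F a b + WC (n - 1)"
      using deligne_I_surj[of a b] ab by simp
    also have "\<dots> \<subseteq> bigraded_lift n p q"
      unfolding bigraded_lift_def
      using I[of a b] F_antimono[OF ab(1)] F'_antimono[OF ab(2)] unfolding ab(3)
      by (intro set_plus_mono2 order.refl) blast
    finally show "grF n a \<inter> grF' n b \<subseteq> bigraded_lift n p q" .
  qed
  then show "\<forall>n p q. bigraded_lift n p q = grF n p \<inter> grF' n q"
    using bigraded_lift_subset by blast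
next
  assume lift: "\<forall>n p q. bigraded_lift n p q = grF n p \<inter> grF' n q"
  have I: "deligne_I W F p q = F p \<inter> F' q \<inter> WC (p + q)" for p q
  proof
    let ?n = "p + q"
    let ?U = "cplx.span (\<Union>i\<in>{1..}. F' (q - i) \<inter> WC (?n - i - 1))"
    have "F' q \<inter> WC ?n \<subseteq> F' q \<inter> WC ?n + ?U"
      by (intro subset_set_plus cplx.subspace_inter subspaces cplx.subspace_span)
    then show J: "F p \<inter> F' q \<inter> WC ?n \<subseteq> deligne_I W F p q"
      unfolding deligne_I_def Let_def by blast
    have sub: "cplx.subspace (deligne_I W F p q)"
      unfolding deligne_I_def Let_def
      by (intro cplx.subspace_inter subspace_set_plus subspaces cplx.subspace_span)
    show "deligne_I W F p q \<subseteq> F p \<inter> F' q \<inter> WC ?n"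
    proof
      fix x assume x: "x \<in> deligne_I W F p q"
      have "x \<in> F p \<inter> WC ?n" using x deligne_I_le by blast
      then have "x \<in> grF ?n p" using le_gr by blast
      have "x \<in> F' q + WC (?n - 2)" using deligne_I_subset[of 0 p q] x by auto
      then obtain u w where uw: "x = u + w" "u \<in> F' q" "w \<in> WC (?n - 2)"
        by (auto elim!: set_plus_elim)
      have "w \<in> WC ?n" "w \<in> WC (?n - 1)"
        using uw mono_WC[of "?n - 2" ?n] mono_WC[of "?n - 2" "?n - 1"] by auto
      moreover have "u = x - w" using uw by simp
      ultimately have "u \<in> WC ?n"
        using \<open>x \<in> F p \<inter> WC ?n\<close>
          cplx.subspace_diff[OF subspace_complexify_filtration, of x ?n w] by simp
      then have "x \<in> grF' ?n q"
        using uw \<open>w \<in> WC (?n - 1)\<close> unfolding grF'_eq by auto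
      with \<open>x \<in> grF ?n p\<close> have "x \<in> bigraded_lift ?n p q" using lift by auto
      then obtain y z where yz: "x = y + z" "y \<in> F p \<inter> F' q \<inter> WC ?n" "z \<in> WC (?n - 1)"
        unfolding bigraded_lift_def by (auto elim!: set_plus_elim)
      \<comment> \<open>Both \<open>x\<close> and \<open>y\<close> lie in
        \<open>deligne_I W F p q\<close>, hence so does \<open>z\<close>; being of lower weight, it
        vanishes.\<close>
      have "z = x - y" using yz by simp
      then have "z \<in> deligne_I W F p q"
        using cplx.subspace_diff[OF sub x subsetD[OF J yz(2)]] by simp
      then have "z = 0" using deligne_I_inj yz by blast
      then show "x \<in> F p \<inter> F' q \<inter> WC ?n" using yz by simp
    qed
  qed
  \<comment> \<open>The weight filtration is real, so conjugation fixes it and only exchanges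
    \<open>F\<close> and \<open>F'\<close>.\<close>
  have "cconj ` WC n = WC n" for n
  proof -
    have "cconj ` WC n \<subseteq> WC n"
      using real_vector.subspace_neg[OF subspace_W]
      by (auto simp: cconj_def complexify_filtration_def)
    then show ?thesis using image_mono[of "cconj ` WC n" "WC n" cconj] by auto
  qed
  then show "R_split W F"
    unfolding R_split_def I cconj_image_Int conj_filtration_def
    by (simp add: add.commute Int_commute)
qed

section \<open>The level as a sum of lifting defects\<close>

lemma subspace_dim_Int_plus:
  fixes A B C :: "('v \<times> 'v) set"
  assumes "cplx.subspace A" "cplx.subspace B" "cplx.subspace C" "B \<subseteq> C"
  shows "int (cplx.dim (A \<inter> C + B)) = int (cplx.dim (A \<inter> C)) + cplx.dim B - cplx.dim (A \<inter> B)"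
proof -
  have "A \<inter> C \<inter> B = A \<inter> B" using assms(4) by blast
  then show ?thesis
    using dim_set_plus[OF cplx.subspace_inter[OF assms(1,3)] assms(2)] by simp
qed

text \<open>The right-hand side is symmetric in the two filtrations. Hence the order of grading,
  which differs between \<open>hodge_number\<close> and the axiom \<open>opposed\<close>, does not
  affect the dimension.\<close>

lemma subquotient_dim_Gr_Gr:
  fixes G H :: "int \<Rightarrow> ('v \<times> 'v) set"
  assumes G: "\<And>p. cplx.subspace (G p)" "antimono G"
    and H: "\<And>q. cplx.subspace (H q)" "antimono H"
    and X: "cplx.subspace (fst X)" "cplx.subspace (snd X)" "snd X \<subseteq> fst X"
  defines "g \<equiv> \<lambda>p q. int (cplx.dim (induced G p X \<inter> induced H q X))"
  shows "int (subquotient_dim (Gr_decr G p (Gr_decr H q X))) =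
    g p q - g (p + 1) q - g p (q + 1) + g (p + 1) (q + 1)"
proof -
  define S where "S = (\<lambda>q. induced H q X)"
  have S: "cplx.subspace (S q)" for q
    unfolding S_def by (rule subspace_induced[OF H(1) X(1,2)])
  have XS: "snd X \<subseteq> S q" for q
    unfolding S_def induced_def by (intro subset_set_plus cplx.subspace_inter H X)
  have SX: "S q \<subseteq> fst X" for q
    unfolding S_def induced_def by (intro set_plus_subset_subspace X) blast
  have SS: "S (q + 1) \<subseteq> S q" for q
    unfolding S_def induced_def using antimonoD[OF H(2), of q "q + 1"]
    by (intro set_plus_mono2 order.refl) auto
  \<comment> \<open>Dedekind's modular law, from \<open>snd X \<subseteq> S q\<close>.\<close>
  have modular: "induced G p X \<inter> S q = G p \<inter> S q + snd X" for p q
  proof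
    show "G p \<inter> S q + snd X \<subseteq> induced G p X \<inter> S q"
      unfolding induced_def using SX[of q] XS[of q] S[of q]
      by (intro Int_greatest set_plus_mono2 set_plus_subset_subspace) auto
    show "induced G p X \<inter> S q \<subseteq> G p \<inter> S q + snd X"
    proof
      fix x assume x: "x \<in> induced G p X \<inter> S q"
      then obtain f w where fw: "x = f + w" "f \<in> G p" "w \<in> snd X"
        unfolding induced_def by (blast elim: set_plus_elim)
      have "x - w \<in> S q"
        using x fw(3) XS[of q] cplx.subspace_diff[OF S, of x q w] by blast
      then have "f \<in> S q" using fw(1) by simp
      then show "x \<in> G p \<inter> S q + snd X"
        using fw by blast
    qed
  qed
  have g: "g p q = cplx.dim (G p \<inter> S q) + cplx.dim (snd X) - int (cplx.dim (G p \<inter> snd X))" for p q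
    using subspace_dim_Int_plus[OF G(1) X(2) S XS, of p q] modular[of p q]
    by (simp add: g_def S_def)
  have num: "int (cplx.dim (induced G p (Gr_decr H q X))) =
      cplx.dim (G p \<inter> S q) + cplx.dim (S (q + 1)) - int (cplx.dim (G p \<inter> S (q + 1)))" for p
    using subspace_dim_Int_plus[OF G(1) S S SS] by (simp add: induced_def[of G] Gr_decr_def S_def)
  have "induced G (p + 1) (Gr_decr H q X) \<subseteq> induced G p (Gr_decr H q X)"
    unfolding induced_def[of G] using antimonoD[OF G(2), of p "p + 1"]
    by (intro set_plus_mono2 order.refl) auto
  note dim_mono[OF this]
  then have "int (subquotient_dim (Gr_decr G p (Gr_decr H q X))) =
      int (cplx.dim (induced G p (Gr_decr H q X))) - cplx.dim (induced G (p + 1) (Gr_decr H q X))"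
    by (simp add: subquotient_dim_def Gr_decr_def[of G] of_nat_diff)
  \<comment> \<open>The terms with \<open>snd X\<close> cancel in the mixed difference, and so does
    \<open>cplx.dim (S (q + 1))\<close>, which is the same for \<open>p\<close> and
    \<open>p + 1\<close>.\<close>
  also have "\<dots> = g p q - g (p + 1) q - g p (q + 1) + g (p + 1) (q + 1)"
    unfolding num g by simp
  finally show ?thesis .
qed

lemma antimono_F': "antimono F'"
  using F'_antimono by (intro antimonoI)

text \<open>Counted in \<open>WC n\<close> instead of the quotient, hence too large by the dimension
  of \<open>WC (n - 1)\<close>. The same surplus occurs in \<open>lift_rank\<close>, so their
  difference is the true defect.\<close>

definition gr_rank :: "int \<Rightarrow> int \<Rightarrow> int \<Rightarrow> int" where
  "gr_rank n p q = cplx.dim (grF n p \<inter> grF' n q)"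

definition lift_rank :: "int \<Rightarrow> int \<Rightarrow> int \<Rightarrow> int" where
  "lift_rank n p q = cplx.dim (bigraded_lift n p q)"

lemma Gr_W_subspaces:
  "cplx.subspace (fst (Gr_incr WC n whole))" "cplx.subspace (snd (Gr_incr WC n whole))"
  "snd (Gr_incr WC n whole) \<subseteq> fst (Gr_incr WC n whole)"
  unfolding Gr_W_eq using subspaces mono_WC[of "n - 1" n] by auto

lemma hodge_number_eq:
  "int (hodge_number W F p q) = gr_rank (p + q) p q - gr_rank (p + q) (p + 1) q
     - gr_rank (p + q) p (q + 1) + gr_rank (p + q) (p + 1) (q + 1)"
  unfolding hodge_number_def gr_rank_def
  using subquotient_dim_Gr_Gr[OF subspaces(2) antimono_F' subspaces(1) antimono_F Gr_W_subspaces,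
      of q p "p + q"]
  by (simp add: Int_commute)

lemma gr_rank_diff_eq_0:
  assumes "p + q \<noteq> n"
  shows "gr_rank n p q - gr_rank n (p + 1) q - gr_rank n p (q + 1) + gr_rank n (p + 1) (q + 1) = 0"
proof -
  have "subquotient_dim (Gr_decr F p (Gr_decr F' q (Gr_incr WC n whole))) = 0"
    using opposed[OF assms] by (simp add: is_zero_subquotient_def subquotient_dim_def)
  then show ?thesis
    unfolding gr_rank_def
    using subquotient_dim_Gr_Gr[OF subspaces(1) antimono_F subspaces(2) antimono_F' Gr_W_subspaces,
        of p q n]
    by simp
qed

lemma s_number_eq:
  "int (s_number F p q) = int (cplx.dim (F p \<inter> F' q)) - cplx.dim (F (p + 1) \<inter> F' q)
     - cplx.dim (F p \<inter> F' (q + 1)) + cplx.dim (F (p + 1) \<inter> F' (q + 1))"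
proof -
  have "induced G r whole = G r" for G :: "int \<Rightarrow> ('v \<times> 'v) set" and r
    by (simp add: induced_def whole_def)
  then show ?thesis
    unfolding s_number_def
    using subquotient_dim_Gr_Gr[OF subspaces(1) antimono_F subspaces(2) antimono_F',
        where X = whole and p = p and q = q]
    by (simp add: whole_def)
qed

lemma lift_rank_le: "lift_rank n p q \<le> gr_rank n p q"
  unfolding lift_rank_def gr_rank_def using dim_mono[OF bigraded_lift_subset] by simp

lemma lift_rank_eq_iff:
  "lift_rank n p q = gr_rank n p q \<longleftrightarrow> bigraded_lift n p q = grF n p \<inter> grF' n q"
proof
  assume "lift_rank n p q = gr_rank n p q"
  then show "bigraded_lift n p q = grF n p \<inter> grF' n q"
    unfolding lift_rank_def gr_rank_def
    by (intro subspace_dim_equal subspace_bigraded_lift cplx.subspace_inter subspace_gr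
        bigraded_lift_subset) simp
qed (simp add: lift_rank_def gr_rank_def)

lemma lift_rank_eq:
  "lift_rank n p q = int (cplx.dim (F p \<inter> F' q \<inter> WC n)) - cplx.dim (F p \<inter> F' q \<inter> WC (n - 1))
     + cplx.dim (WC (n - 1))"
  unfolding lift_rank_def bigraded_lift_def
  using subspace_dim_Int_plus[OF cplx.subspace_inter[OF subspaces(1,2)] subspaces(3) subspaces(3),
      of "n - 1" n p q] mono_WC[of "n - 1" n]
  by simp

lemma WC_le_bigraded_lift: "WC (n - 1) \<subseteq> bigraded_lift n p q"
  unfolding bigraded_lift_def by (intro subset_set_plus cplx.subspace_inter subspaces)

text \<open>Bounds the support of the defect in all three indices: in each case every class in the
  intersection is zero or has an evident common representative.\<close>

lemma lift_rank_trivial: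
  assumes "F p \<in> {UNIV, {0}} \<or> F' q \<in> {UNIV, {0}} \<or> WC (n - 1) = WC n"
  shows "lift_rank n p q = gr_rank n p q"
proof -
  have "0 \<in> WC m" for m
    by (rule cplx.subspace_0[OF subspace_complexify_filtration])
  then have zero: "{0} \<inter> WC m + WC (m - 1) = WC (m - 1)" for m
    by (simp add: Int_absorb2)
  consider "F p = UNIV" | "F p = {0}" | "F' q = UNIV" | "F' q = {0}" | "WC (n - 1) = WC n"
    using assms by blast
  then have "grF n p \<inter> grF' n q \<subseteq> bigraded_lift n p q"
  proof cases
    case 1
    then show ?thesis unfolding grF'_eq bigraded_lift_def by simp
  next
    case 2
    then have "grF n p = WC (n - 1)" unfolding grF_eq by (simp only: zero)
    then show ?thesis using WC_le_bigraded_lift by blast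
  next
    case 3
    then show ?thesis unfolding grF_eq bigraded_lift_def by simp
  next
    case 4
    then have "grF' n q = WC (n - 1)" unfolding grF'_eq by (simp only: zero)
    then show ?thesis using WC_le_bigraded_lift by blast
  next
    case 5
    then show ?thesis using WC_le_bigraded_lift[of n p q] gr_le(1)[of p n] by blast
  qed
  then show ?thesis
    unfolding lift_rank_eq_iff by (rule equalityI[OF bigraded_lift_subset])
qed

lemma sum_telescope_int:
  fixes k :: "int \<Rightarrow> 'b::ab_group_add"
  assumes "c \<le> d"
  shows "(\<Sum>n\<in>{c<..d}. k n - k (n - 1)) = k d - k c"
  using assms
proof (induction d rule: int_ge_induct)
  case (step d)
  then have "{c<..d + 1} = insert (d + 1) {c<..d}" by auto
  then show ?case using step by simp
qed simp

text \<open>By opposedness only weight \<open>p + q\<close> contributes to the mixed difference of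
  \<open>gr_rank\<close>. Over the weights, \<open>lift_rank\<close> telescopes to the dimension of
  \<open>F p \<inter> F' q\<close> plus a constant free of \<open>p\<close> and \<open>q\<close>,
  which the mixed difference removes.\<close>

lemma hodge_number_diff_s_number:
  assumes "c \<le> d" "\<And>n. n \<le> c \<Longrightarrow> WC n = {0}" "\<And>n. n \<ge> d \<Longrightarrow> WC n = UNIV"
  defines "D \<equiv> \<lambda>p q. \<Sum>n\<in>{c<..d}. gr_rank n p q - lift_rank n p q"
  shows "int (hodge_number W F p q) - int (s_number F p q) =
    D p q - D (p + 1) q - D p (q + 1) + D (p + 1) (q + 1)"
proof -
  define \<Delta> where "\<Delta> = (\<lambda>n. gr_rank n p q - gr_rank n (p + 1) q - gr_rank n p (q + 1)
    + gr_rank n (p + 1) (q + 1))"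
  have "\<Delta> n = 0" if "n \<notin> {c<..d}" for n
  proof -
    have "WC (n - 1) = WC n" using that assms(2)[of n] assms(2)[of "n - 1"] assms(3)[of n]
        assms(3)[of "n - 1"] by (cases "n \<le> c") auto
    then have "grF n i = WC n" "grF' n i = WC n" for i
      using gr_le[of i n] gr_ge(1)[of n i] gr_ge(2)[of n i] by auto
    then show ?thesis by (simp add: \<Delta>_def gr_rank_def)
  qed
  moreover have "\<Delta> n = 0" if "n \<noteq> p + q" for n
    using gr_rank_diff_eq_0[of p q n] that by (simp add: \<Delta>_def)
  \<comment> \<open>The weight \<open>p + q\<close> may lie outside \<open>{c<..d}\<close>; then
    both sums are zero.\<close>
  ultimately have "(\<Sum>n\<in>{c<..d}. \<Delta> n) = (\<Sum>n\<in>{p + q}. \<Delta> n)"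
    by (intro sum.mono_neutral_cong) auto
  then have gr: "(\<Sum>n\<in>{c<..d}. \<Delta> n) = hodge_number W F p q"
    by (simp add: \<Delta>_def hodge_number_eq)
  have lift: "(\<Sum>n\<in>{c<..d}. lift_rank n i j)
      = cplx.dim (F i \<inter> F' j) + (\<Sum>n\<in>{c<..d}. int (cplx.dim (WC (n - 1))))" for i j
  proof -
    have "F i \<inter> F' j \<inter> {0} = {0}"
      using cplx.subspace_0[OF subspace_F] cplx.subspace_0[OF subspace_conj_filtration] by blast
    then have "cplx.dim (F i \<inter> F' j \<inter> WC c) = 0"
      using assms(2)[of c] cplx.dim_eq_card[of "{}" "{0}"] cplx.independent_empty
      by (simp add: cplx.span_insert_0)
    then show ?thesis
      using sum_telescope_int[OF assms(1), of "\<lambda>n. int (cplx.dim (F i \<inter> F' j \<inter> WC n))"]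
        assms(3)[of d]
      by (simp add: lift_rank_eq sum.distrib)
  qed
  show ?thesis
    unfolding s_number_eq gr[symmetric] D_def \<Delta>_def
    by (simp add: sum_subtractf sum.distrib lift)
qed

end

section \<open>Summation by parts over pairs of integers\<close>

lemma infsum_diff:
  fixes f g :: "'a \<Rightarrow> real"
  assumes "f summable_on A" "g summable_on A"
  shows "(\<lambda>x. f x - g x) summable_on A" "infsum (\<lambda>x. f x - g x) A = infsum f A - infsum g A"
  using summable_on_add[of f A "\<lambda>x. - g x"] infsum_add[of f A "\<lambda>x. - g x"] assms
  by (simp_all add: summable_on_uminus infsum_uminus)

text \<open>Translating the index pair moves the shift from \<open>D\<close> to the weight
  \<open>w\<close>. Besides squares, the constant weight 1 is used, for the summability of
  \<open>D\<close> itself.\<close>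

lemma infsum_shift:
  fixes D :: "int \<Rightarrow> int \<Rightarrow> real" and w :: "int \<Rightarrow> real"
  assumes "finite {(p, q). D p q \<noteq> 0}"
  shows "(\<lambda>(p, q). w (p + q) * D (p + i) (q + j)) summable_on UNIV"
    and "(\<Sum>\<^sub>\<infinity>(p, q)\<in>UNIV. w (p + q) * D (p + i) (q + j))
      = (\<Sum>\<^sub>\<infinity>(p, q)\<in>UNIV. w (p + q - i - j) * D p q)"
proof -
  let ?\<sigma> = "\<lambda>(p, q). (p + i, q + j)"
  let ?f = "\<lambda>(p, q). w (p + q - i - j) * D p q"
  have bij: "bij_betw ?\<sigma> UNIV UNIV"
    by (rule bij_betwI[where g = "\<lambda>(p, q). (p - i, q - j)"]) auto
  have eq: "(\<lambda>(p, q). w (p + q) * D (p + i) (q + j)) = (\<lambda>x. ?f (?\<sigma> x))"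
    by (auto simp: fun_eq_iff algebra_simps)
  have "{x. ?f x \<noteq> 0} \<subseteq> {(p, q). D p q \<noteq> 0}" by auto
  then have "?f summable_on UNIV"
    by (intro finite_nonzero_values_imp_summable_on) (auto intro: finite_subset[OF _ assms])
  then show "(\<lambda>(p, q). w (p + q) * D (p + i) (q + j)) summable_on UNIV"
    unfolding eq using summable_on_reindex_bij_betw[OF bij, of ?f] by simp
  show "(\<Sum>\<^sub>\<infinity>(p, q)\<in>UNIV. w (p + q) * D (p + i) (q + j)) = infsum ?f UNIV"
    unfolding eq using infsum_reindex_bij_betw[OF bij, of ?f] by simp
qed

text \<open>After reindexing, the shifts \<open>(1, 0)\<close> and \<open>(0, 1)\<close> give the
  same weight, and \<open>n^2 - 2 (n - 1)^2 + (n - 2)^2 = 2\<close> for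
  \<open>n = p + q\<close>.\<close>

lemma infsum_second_difference:
  fixes D :: "int \<Rightarrow> int \<Rightarrow> real"
  assumes "finite {(p, q). D p q \<noteq> 0}"
  shows "(\<Sum>\<^sub>\<infinity>(p, q)\<in>UNIV. (of_int (p + q))\<^sup>2
      * (D p q - D (p + 1) q - D p (q + 1) + D (p + 1) (q + 1)))
    = 2 * (\<Sum>\<^sub>\<infinity>(p, q)\<in>UNIV. D p q)"
proof -
  let ?f = "\<lambda>i j (p, q). (of_int (p + q))\<^sup>2 * D (p + i) (q + j)"
  let ?g = "\<lambda>k (p, q). (of_int (p + q - k))\<^sup>2 * D p q"
  have f: "?f i j summable_on UNIV" for i j
    using infsum_shift(1)[OF assms, of "\<lambda>n. (of_int n)\<^sup>2" i j] by simp
  have fg: "infsum (?f i j) UNIV = infsum (?g (i + j)) UNIV" for i j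
    using infsum_shift(2)[OF assms, of "\<lambda>n. (of_int n)\<^sup>2" i j] by (simp add: diff_diff_eq)
  have g: "?g k summable_on UNIV" for k
    using infsum_shift(1)[OF assms, of "\<lambda>n. (of_int (n - k))\<^sup>2" 0 0] by simp
  have "(\<Sum>\<^sub>\<infinity>(p, q)\<in>UNIV. (of_int (p + q))\<^sup>2
      * (D p q - D (p + 1) q - D p (q + 1) + D (p + 1) (q + 1)))
    = infsum (\<lambda>x. ?f 0 0 x - ?f 1 0 x - ?f 0 1 x + ?f 1 1 x) UNIV"
    by (intro infsum_cong) (auto simp: algebra_simps)
  also have "\<dots> = infsum (?f 0 0) UNIV - infsum (?f 1 0) UNIV - infsum (?f 0 1) UNIV
      + infsum (?f 1 1) UNIV"
    by (simp only: infsum_add infsum_diff summable_on_add f)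
  also have "\<dots> = infsum (?g 0) UNIV - infsum (?g 1) UNIV - infsum (?g 1) UNIV + infsum (?g 2) UNIV"
    by (simp only: fg) simp
  also have "\<dots> = infsum (\<lambda>x. ?g 0 x - ?g 1 x - ?g 1 x + ?g 2 x) UNIV"
    by (simp only: infsum_add infsum_diff summable_on_add g)
  also have "\<dots> = infsum (\<lambda>x. 2 * (case x of (p, q) \<Rightarrow> D p q)) UNIV"
    by (intro infsum_cong) (auto simp: algebra_simps power2_eq_square)
  also have "\<dots> = 2 * (\<Sum>\<^sub>\<infinity>(p, q)\<in>UNIV. D p q)"
    by (rule infsum_cmult_right')
  finally show ?thesis .
qed

theorem proposition38:
  fixes W :: "int \<Rightarrow> 'v::real_vector set"
    and F :: "int \<Rightarrow> ('v \<times> 'v) set"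
  assumes "real_mixed_hodge_structure W F"
  shows "splitting_level W F = 0 \<longleftrightarrow> R_split W F"
proof -
  interpret real_mixed_hodge_structure W F by fact
  obtain c d where cd: "c \<le> d" "\<And>n. n \<le> c \<Longrightarrow> WC n = {0}" "\<And>n. n \<ge> d \<Longrightarrow> WC n = UNIV"
    using WC_bounds by blast
  obtain a b where ab: "\<And>p. p \<le> a \<Longrightarrow> F p = UNIV" "\<And>p. p \<le> a \<Longrightarrow> F' p = UNIV"
    "\<And>p. p \<ge> b \<Longrightarrow> F p = {0}" "\<And>p. p \<ge> b \<Longrightarrow> F' p = {0}"
    using F_bounds by blast
  define D where "D = (\<lambda>p q. \<Sum>n\<in>{c<..d}. gr_rank n p q - lift_rank n p q)"
  have D_nonneg: "D p q \<ge> 0" for p q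
    unfolding D_def using lift_rank_le by (intro sum_nonneg) simp
  have "D p q = 0" if "(p, q) \<notin> {a<..<b} \<times> {a<..<b}" for p q
  proof -
    have "F p \<in> {UNIV, {0}} \<or> F' q \<in> {UNIV, {0}}"
      using that ab(1,3)[of p] ab(2,4)[of q] by force
    then have "lift_rank n p q = gr_rank n p q" for n
      by (intro lift_rank_trivial) blast
    then show ?thesis by (simp add: D_def)
  qed
  then have "{(p, q). D p q \<noteq> 0} \<subseteq> {a<..<b} \<times> {a<..<b}" by blast
  then have fin: "finite {(p, q). D p q \<noteq> 0}"
    by (rule finite_subset) simp
  have "real (hodge_number W F p q) - real (s_number F p q)
      = of_int (D p q) - of_int (D (p + 1) q) - of_int (D p (q + 1)) + of_int (D (p + 1) (q + 1))"
    for p q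
    using arg_cong[OF hodge_number_diff_s_number[OF cd, of p q], of real_of_int]
    unfolding D_def by simp
  \<comment> \<open>The factor 2 from the second difference cancels the 1/2 in
    \<open>splitting_level\<close>.\<close>
  then have level: "splitting_level W F = (\<Sum>\<^sub>\<infinity>(p, q)\<in>UNIV. real_of_int (D p q))"
    using infsum_second_difference[of "\<lambda>p q. real_of_int (D p q)"] fin
    by (simp add: splitting_level_def)
  \<comment> \<open>Summability excludes that the level is 0 merely as the default value of
    \<open>infsum\<close>.\<close>
  have summable: "(\<lambda>(p, q). real_of_int (D p q)) summable_on UNIV"
    using infsum_shift(1)[of "\<lambda>p q. real_of_int (D p q)" "\<lambda>_. 1" 0 0] fin by simp
  have "splitting_level W F = 0 \<longleftrightarrow> (\<forall>p q. D p q = 0)"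
  proof
    assume "splitting_level W F = 0"
    then have "(case (p, q) of (p, q) \<Rightarrow> real_of_int (D p q)) = 0" for p q
      using D_nonneg summable level
      by (intro nonneg_infsum_le_0D[where A = UNIV]) auto
    then show "\<forall>p q. D p q = 0" by simp
  qed (simp add: level case_prod_unfold)
  also have "\<dots> \<longleftrightarrow> (\<forall>p q. \<forall>n\<in>{c<..d}. lift_rank n p q = gr_rank n p q)"
    unfolding D_def using lift_rank_le by (subst sum_nonneg_eq_0_iff) auto
  also have "\<dots> \<longleftrightarrow> (\<forall>n p q. lift_rank n p q = gr_rank n p q)"
  proof -
    \<comment> \<open>Outside the range, \<open>n - 1\<close> and \<open>n\<close> are both at most
      \<open>c\<close> or both at least \<open>d\<close>.\<close>
    have "WC (n - 1) = WC n" if "n \<notin> {c<..d}" for n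
      using that cd(2)[of n] cd(2)[of "n - 1"] cd(3)[of n] cd(3)[of "n - 1"]
      by (cases "n \<le> c") auto
    then have "lift_rank n p q = gr_rank n p q" if "n \<notin> {c<..d}" for n p q
      using that by (intro lift_rank_trivial disjI2)
    then show ?thesis by blast
  qed
  also have "\<dots> \<longleftrightarrow> R_split W F"
    by (simp add: R_split_iff lift_rank_eq_iff)
  finally show ?thesis .
qed

end
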